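(* Let $(X,\mathcal{X},\mu,T)$ be a system. Then $(T^n,T^{n+\lfloor\log_2n\rfloor})_n$ is jointly ergodic if and only if $T$ is (strongly) mixing. By contrast, $(T^{\lfloor\log_2n\rfloor})_n$ is ergodic if and only if the system is conjugate to a one-point system, or equivalently $\mu$ is concentrated on a single point. Consequently, if $T$ is mixing but the system is not conjugate to a one-point system, then $(T^n,T^{n+\lfloor\log_2n\rfloor})_n$ is jointly ergodic whereas $(T^{\lfloor\log_2n\rfloor})_n$ is not ergodic.
   Context: A system $(X,\mathcal{X},\mu,T)$ consists of an invertible measure preserving transformation $T$ of a Lebesgue probability space $(X,\mathcal{X},\mu)$; $Tf=f\circ T$. Write $[N]=\{1,\ldots,N\}$ and $\mathbb{E}_{n\in[N]}=\frac1N\sum_{n=1}^N$. For integer sequences $b_1,b_2$, $(T^{b_1(n)},T^{b_2(n)})_n$ is jointly ergodic if $\lim_{N\to\infty}\left\|\mathbb{E}_{n\in[N]}T^{b_1(n)}f_1\cdot T^{b_2(n)}f_2-\int f_1\,d\mu\int f_2\,d\mu\right\|_{L^2(\mu)}=0$ for all $f_1,f_2\in L^\infty(\mu)$. The sequence $(T^{b(n)})_n$ is ergodic if $\lim_{N\to\infty}\|\mathbb{E}_{n\in[N]}T^{b(n)}f-\int f\,d\mu\|_{L^2(\mu)}=0$ for all $f\in L^\infty(\mu)$. $T$ is (strongly) mixing if $\lim_{n\to\infty}\int f\cdot T^ng\,d\mu=\int f\,d\mu\int g\,d\mu$ for all $f,g\in L^2(\mu)$. *)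

theory Defs
  imports "HOL-Probability.Probability"
begin

definition measure_iso :: "'a measure \<Rightarrow> 'b measure \<Rightarrow> ('a \<Rightarrow> 'b) \<Rightarrow> bool" where
  "measure_iso M N \<phi> \<longleftrightarrow>
     bij_betw \<phi> (space M) (space N) \<and>
     \<phi> \<in> M \<rightarrow>\<^sub>M N \<and> inv_into (space M) \<phi> \<in> N \<rightarrow>\<^sub>M M \<and>
     distr M N \<phi> = N"

definition conull :: "'a measure \<Rightarrow> 'a set \<Rightarrow> bool" where
  "conull M A \<longleftrightarrow> A \<in> sets M \<and> space M - A \<in> null_sets M"

definition iso_mod_null :: "'a measure \<Rightarrow> 'b measure \<Rightarrow> bool" where
  "iso_mod_null M N \<longleftrightarrow>
     (\<exists>A B \<phi>. conull M A \<and> conull N B \<and>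
        measure_iso (restrict_space M A) (restrict_space N B) \<phi>)"

text \<open>
  A Lebesgue (standard) probability space: modulo null sets, the disjoint union of countably many
  atoms (the set \<open>C\<close>, possibly empty) and an interval with Lebesgue measure (possibly degenerate,
  when the atoms carry all the mass).  Passing to the completion means that both complete spaces and
  standard Borel spaces are admitted.
\<close>

definition lebesgue_prob_space :: "'a measure \<Rightarrow> bool" where
  "lebesgue_prob_space M \<longleftrightarrow>
     prob_space M \<and>
     (\<exists>C. C \<subseteq> space M \<and> countable C \<and> (\<forall>x\<in>C. measure M {x} > 0) \<and>
        iso_mod_null (restrict_space (completion M) (space M - C))
                     (lebesgue_on {0..measure M (space M - C)}))"

definition mp_system :: "'a measure \<Rightarrow> ('a \<Rightarrow> 'a) \<Rightarrow> bool" where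
  "mp_system M T \<longleftrightarrow> lebesgue_prob_space M \<and> measure_iso M M T"

definition conjugate :: "'a measure \<Rightarrow> ('a \<Rightarrow> 'a) \<Rightarrow> 'b measure \<Rightarrow> ('b \<Rightarrow> 'b) \<Rightarrow> bool" where
  "conjugate M T N S \<longleftrightarrow>
     (\<exists>A B \<phi>. conull M A \<and> conull N B \<and> T ` A \<subseteq> A \<and> S ` B \<subseteq> B \<and>
        measure_iso (restrict_space M A) (restrict_space N B) \<phi> \<and>
        (\<forall>x\<in>A. \<phi> (T x) = S (\<phi> x)))"

definition conjugate_to_one_point :: "'a measure \<Rightarrow> ('a \<Rightarrow> 'a) \<Rightarrow> bool" where
  "conjugate_to_one_point M T \<longleftrightarrow> conjugate M T (count_space {()}) id"

definition concentrated_on_point :: "'a measure \<Rightarrow> bool" where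
  "concentrated_on_point M \<longleftrightarrow> (\<exists>x\<in>space M. {x} \<in> sets M \<and> measure M {x} = 1)"

definition int_iter :: "'a measure \<Rightarrow> ('a \<Rightarrow> 'a) \<Rightarrow> int \<Rightarrow> 'a \<Rightarrow> 'a" where
  "int_iter M T k =
     (if 0 \<le> k then T ^^ nat k else inv_into (space M) T ^^ nat (- k))"

text \<open>The action on functions: \<open>koopman M T k f\<close> is \<open>T\<^sup>k f\<close>.\<close>

definition koopman :: "'a measure \<Rightarrow> ('a \<Rightarrow> 'a) \<Rightarrow> int \<Rightarrow> ('a \<Rightarrow> complex) \<Rightarrow> 'a \<Rightarrow> complex" where
  "koopman M T k f = f \<circ> int_iter M T k"

definition Linfty :: "'a measure \<Rightarrow> ('a \<Rightarrow> complex) set" where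
  "Linfty M = {f \<in> borel_measurable M. \<exists>c. AE x in M. norm (f x) \<le> c}"

definition L2 :: "'a measure \<Rightarrow> ('a \<Rightarrow> complex) set" where
  "L2 M = {f \<in> borel_measurable M. integrable M (\<lambda>x. (norm (f x))\<^sup>2)}"

definition L2_norm :: "'a measure \<Rightarrow> ('a \<Rightarrow> complex) \<Rightarrow> real" where
  "L2_norm M f = sqrt (\<integral>x. (norm (f x))\<^sup>2 \<partial>M)"

definition jointly_ergodic ::
    "'a measure \<Rightarrow> ('a \<Rightarrow> 'a) \<Rightarrow> (nat \<Rightarrow> int) \<Rightarrow> (nat \<Rightarrow> int) \<Rightarrow> bool" where
  "jointly_ergodic M T b1 b2 \<longleftrightarrow>
     (\<forall>f1\<in>Linfty M. \<forall>f2\<in>Linfty M.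
        (\<lambda>N. L2_norm M (\<lambda>x.
            (\<Sum>n=1..N. koopman M T (b1 n) f1 x * koopman M T (b2 n) f2 x) / of_nat N
              - (\<integral>y. f1 y \<partial>M) * (\<integral>y. f2 y \<partial>M))) \<longlonglongrightarrow> 0)"

definition ergodic_along :: "'a measure \<Rightarrow> ('a \<Rightarrow> 'a) \<Rightarrow> (nat \<Rightarrow> int) \<Rightarrow> bool" where
  "ergodic_along M T b \<longleftrightarrow>
     (\<forall>f\<in>Linfty M.
        (\<lambda>N. L2_norm M (\<lambda>x.
            (\<Sum>n=1..N. koopman M T (b n) f x) / of_nat N - (\<integral>y. f y \<partial>M))) \<longlonglongrightarrow> 0)"

definition mixing :: "'a measure \<Rightarrow> ('a \<Rightarrow> 'a) \<Rightarrow> bool" where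
  "mixing M T \<longleftrightarrow>
     (\<forall>f\<in>L2 M. \<forall>g\<in>L2 M.
        (\<lambda>n::nat. \<integral>x. f x * koopman M T (int n) g x \<partial>M)
          \<longlonglongrightarrow> (\<integral>x. f x \<partial>M) * (\<integral>x. g x \<partial>M))"

end

theory Submission
  imports Defs
begin

text \<open>
  Write \<open>l(n) = \<lfloor>log\<^sub>2 n\<rfloor>\<close>.  Everything rests on the fact that \<open>l\<close> is constant on the dyadic blocks
  \<open>[2\<^sup>k, 2\<^sup>k\<^sup>+\<^sup>1)\<close>, which are eventually long compared with any fixed window, and each of which is longer than
  all earlier blocks together.

  Because a block outweighs its predecessors, convergence of averages of quantities that depend on \<open>l(n)\<close> alone is
  convergence of the quantities themselves (\<open>sublinear_imp_dyadic_null\<close>).  If \<open>(T\<^sup>n, T\<^sup>n\<^sup>+\<^sup>l\<^sup>(\<^sup>n\<^sup>))\<close> is jointly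
  ergodic, integrating the averages therefore shows that the correlations
  \<open>\<integral> f1 \<cdot> T\<^sup>k f2\<close> converge to \<open>\<integral> f1 \<cdot> \<integral> f2\<close>; this is mixing for bounded functions, and density gives it for all
  square-integrable ones.  If \<open>T\<^sup>l\<^sup>(\<^sup>n\<^sup>)\<close> is ergodic, the same argument in norm shows that \<open>T\<^sup>k f\<close> converges to
  \<open>\<integral> f\<close>.  As the distance between the two is independent of \<open>k\<close>, every bounded \<open>f\<close> is constant almost everywhere, every
  measurable set has measure zero or one, and on a Lebesgue space this leaves a single atom.

  For the implication from mixing to joint ergodicity put \<open>c = \<integral> f1 \<cdot> \<integral> f2\<close> and \<open>G\<^sub>k = f1 \<cdot> T\<^sup>k f2 - c\<close>.  On a
  window of fixed length \<open>H\<close> inside the block of level \<open>k\<close>, the sum of the centred products is a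
  translate of \<open>\<Sum>h<H. T\<^sup>h G\<^sub>k\<close>.  An inequality of van der Corput type (\<open>L2_norm_ergodic_sum_le\<close>) bounds its norm
  by the correlations \<open>\<integral> T\<^sup>d G\<^sub>k \<cdot> cnj G\<^sub>k\<close> with \<open>d < H\<close>.  By mixing these tend, as \<open>k \<rightarrow> \<infinity>\<close>, to
  \<open>(\<integral> T\<^sup>d f1 \<cdot> cnj f1) (\<integral> T\<^sup>d f2 \<cdot> cnj f2) - |c|\<^sup>2\<close>, which is itself small for large \<open>d\<close>.  So all windows of a suitable
  length \<open>H\<close> in blocks of high level have small average, and windows that meet two blocks are too
  rare to matter (\<open>sublinear_of_slow_increments\<close>).
\<close>

section \<open>Dyadic levels and sublinear growth\<close>

text \<open>
  Taken in \<^typ>\<open>nat\<close>, because for \<open>n \<ge> 1\<close> the exponents \<open>n\<close> and \<open>n + \<lfloor>log\<^sub>2 n\<rfloor>\<close> are nonnegative, and so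
  only forward iterates of \<open>T\<close> enter the averages.
\<close>
definition dyadic_level :: "nat \<Rightarrow> nat" where
  "dyadic_level n = nat \<lfloor>log 2 (real n)\<rfloor>"

lemma dyadic_level_eqI:
  assumes "2 ^ k \<le> n" "n < 2 ^ Suc k"
  shows "dyadic_level n = k"
proof -
  have "\<lfloor>log (real 2) (real n)\<rfloor> = int k"
    using assms by (intro floor_log_nat_eq_if) auto
  then show ?thesis by (simp add: dyadic_level_def)
qed

lemma int_dyadic_level: "1 \<le> n \<Longrightarrow> \<lfloor>log 2 (real n)\<rfloor> = int (dyadic_level n)"
  by (simp add: dyadic_level_def)

lemma dyadic_level_mono: "mono dyadic_level"
proof (rule monoI)
  fix m n :: nat assume "m \<le> n"
  show "dyadic_level m \<le> dyadic_level n"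
  proof (cases "m = 0")
    case True
    then show ?thesis by (simp add: dyadic_level_def log_def)
  next
    case False
    then have "log 2 (real m) \<le> log 2 (real n)" using \<open>m \<le> n\<close> by simp
    then show ?thesis unfolding dyadic_level_def by (intro nat_mono floor_mono)
  qed
qed

lemma le_dyadic_level: "2 ^ k \<le> n \<Longrightarrow> k \<le> dyadic_level n"
  using monoD[OF dyadic_level_mono, of "2 ^ k" n] dyadic_level_eqI[of k "2 ^ k"] by simp

lemma dyadic_level_sublinear: "(\<lambda>N. real (dyadic_level N) / real N) \<longlonglongrightarrow> 0"
proof (rule tendsto_sandwich[where f="\<lambda>_. 0" and h="\<lambda>N. log 2 (real N) / real N"])
  show "\<forall>\<^sub>F N in sequentially. real (dyadic_level N) / real N \<le> log 2 (real N) / real N"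
  proof (rule eventually_sequentiallyI[of 1])
    fix N :: nat assume "1 \<le> N"
    then have "real (dyadic_level N) \<le> log 2 (real N)"
      by (simp add: dyadic_level_def)
    then show "real (dyadic_level N) / real N \<le> log 2 (real N) / real N"
      by (intro divide_right_mono) auto
  qed
  show "(\<lambda>N. log 2 (real N) / real N) \<longlonglongrightarrow> 0"
    using tendsto_divide[OF lim_ln_over_n tendsto_const[of "ln 2"]] by (simp add: log_def mult.commute)
qed auto

text \<open>
  The level equals \<open>k\<close> on the whole block \<open>[2\<^sup>k, 2\<^sup>k\<^sup>+\<^sup>1)\<close>.  Hence the partial sums up to its
  two ends determine the single term \<open>F k\<close>.
\<close>
lemma sum_dyadic_block:
  fixes F :: "nat \<Rightarrow> 'b::comm_ring_1"
  shows "(\<Sum>n=1..2 ^ Suc k - 1. F (dyadic_level n)) =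
         (\<Sum>n=1..2 ^ k - 1. F (dyadic_level n)) + 2 ^ k * F k"
proof -
  have "(\<Sum>n=1..2 ^ Suc k - 1. F (dyadic_level n)) = (\<Sum>n=1..<2 ^ Suc k. F (dyadic_level n))"
    by (intro sum.cong) auto
  also have "\<dots> = (\<Sum>n=1..<2 ^ k. F (dyadic_level n)) + (\<Sum>n=2 ^ k..<2 ^ Suc k. F (dyadic_level n))"
    by (rule sum.atLeastLessThan_concat[symmetric]) auto
  also have "(\<Sum>n=2 ^ k..<2 ^ Suc k. F (dyadic_level n)) = (\<Sum>n=2 ^ k..<(2 ^ Suc k :: nat). F k)"
    by (intro sum.cong) (auto simp: dyadic_level_eqI)
  also have "\<dots> = 2 ^ k * F k" by simp
  also have "(\<Sum>n=1..<2 ^ k. F (dyadic_level n)) = (\<Sum>n=1..2 ^ k - 1. F (dyadic_level n))"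
    by (intro sum.cong) auto
  finally show ?thesis .
qed

text \<open>
  The block on which the level is \<open>k\<close> makes up at least half of the range up to its end.  Therefore averages
  that tend to zero leave nothing for any single level: both implications that start from
  ergodicity are instances of this lemma, with \<open>S N\<close> the norm of the sum of the first \<open>N\<close> terms.
\<close>
lemma sublinear_imp_dyadic_null:
  fixes S \<phi> :: "nat \<Rightarrow> real"
  assumes "\<And>k. 0 \<le> \<phi> k"
    and "\<And>k. 2 ^ k * \<phi> k \<le> S (2 ^ Suc k - 1) + S (2 ^ k - 1)"
    and S: "(\<lambda>N. S N / real N) \<longlonglongrightarrow> 0"
  shows "\<phi> \<longlonglongrightarrow> 0"
proof -
  have lim: "filterlim (\<lambda>k. 2 ^ k - 1 :: nat) at_top sequentially"
  proof (rule filterlim_at_top_mono[OF filterlim_ident])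
    show "\<forall>\<^sub>F k in sequentially. k \<le> 2 ^ k - 1"
      using less_exp by (intro always_eventually allI) (simp add: less_imp_le_nat Suc_leI le_diff_conv2)
  qed
  define R where "R k = S (2 ^ k - 1) / real (2 ^ k - 1)" for k
  have R: "R \<longlonglongrightarrow> 0" unfolding R_def by (rule filterlim_compose[OF S lim])
  have Sk: "S (2 ^ k - 1) = R k * (2 ^ k - 1)" if "1 \<le> k" for k
  proof -
    have "(1::real) < 2 ^ k" using that by simp
    then show ?thesis by (simp add: R_def of_nat_diff)
  qed
  have "\<phi> k \<le> 2 * \<bar>R (Suc k)\<bar> + \<bar>R k\<bar>" if "1 \<le> k" for k
  proof -
    have "2 ^ k * \<phi> k \<le> R (Suc k) * (2 ^ Suc k - 1) + R k * (2 ^ k - 1)"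
      using assms(2)[of k] Sk[of k] Sk[of "Suc k"] that by simp
    also have "\<dots> \<le> \<bar>R (Suc k)\<bar> * 2 ^ Suc k + \<bar>R k\<bar> * 2 ^ k"
    proof (intro add_mono mult_mono)
      show "(0::real) \<le> 2 ^ Suc k - 1" using one_le_power[of "2::real" "Suc k"] by linarith
      show "(0::real) \<le> 2 ^ k - 1" using one_le_power[of "2::real" k] by linarith
    qed auto
    also have "\<dots> = 2 ^ k * (2 * \<bar>R (Suc k)\<bar> + \<bar>R k\<bar>)" by (simp add: algebra_simps)
    finally show ?thesis by simp
  qed
  then have ev: "\<forall>\<^sub>F k in sequentially. \<phi> k \<le> 2 * \<bar>R (Suc k)\<bar> + \<bar>R k\<bar>"
    by (intro eventually_sequentiallyI)
  have "(\<lambda>k. 2 * \<bar>R (Suc k)\<bar> + \<bar>R k\<bar>) \<longlonglongrightarrow> 2 * \<bar>0\<bar> + \<bar>0\<bar>"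
    using R LIMSEQ_Suc[OF R] by (intro tendsto_intros)
  then show ?thesis
    using assms(1) ev by (intro tendsto_sandwich[OF _ ev tendsto_const]) auto
qed

text \<open>
  A growth criterion adapted to windows of length \<open>H\<close>.  If \<open>S\<close> is the norm of a partial sum, a window
  is good when it adds at most \<open>\<epsilon> H\<close>, and a bad window may be charged to the growth of \<open>l\<close>; as \<open>l\<close> grows
  sublinearly, bad windows do not matter.  The proof observes that \<open>S N - \<epsilon> N - B l(N)\<close> does not
  increase when \<open>N\<close> moves by \<open>H\<close>, and so is bounded by its values on one initial window.
\<close>
lemma sublinear_of_slow_increments:
  fixes S :: "nat \<Rightarrow> real" and l :: "nat \<Rightarrow> nat"
  assumes nonneg: "\<And>N. 0 \<le> S N"
    and l: "(\<lambda>N. real (l N) / real N) \<longlonglongrightarrow> 0"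
    and step: "\<And>\<epsilon>. 0 < \<epsilon> \<Longrightarrow> \<exists>H\<ge>1. \<exists>N0 B. \<forall>N\<ge>N0.
        S (N + H) \<le> S N + \<epsilon> * real H + B * (real (l (N + H)) - real (l N))"
  shows "(\<lambda>N. S N / real N) \<longlonglongrightarrow> 0"
proof (rule order_tendstoI)
  fix a :: real assume "a < 0"
  then show "\<forall>\<^sub>F N in sequentially. a < S N / real N"
    using nonneg by (intro always_eventually allI) (meson divide_nonneg_nonneg less_le_trans of_nat_0_le_iff)
next
  fix a :: real assume "0 < a"
  then obtain H N0 B where H: "1 \<le> H" and
    inc: "\<And>N. N0 \<le> N \<Longrightarrow> S (N + H) \<le> S N + a / 2 * real H + B * (real (l (N + H)) - real (l N))"
    using step[of "a / 2"] by auto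
  define \<Phi> where "\<Phi> N = S N - a / 2 * real N - B * real (l N)" for N
  define C where "C = Max (\<Phi> ` {N0..<N0 + H})"
  have \<Phi>: "\<Phi> N \<le> C" if "N0 \<le> N" for N
    using that
  proof (induction N rule: less_induct)
    case (less N)
    show ?case
    proof (cases "N < N0 + H")
      case True
      then show ?thesis unfolding C_def using less.prems by (intro Max_ge) auto
    next
      case False
      then have "\<Phi> (N - H) \<le> C" using H by (intro less.IH) auto
      moreover have "\<Phi> N \<le> \<Phi> (N - H)"
        using inc[of "N - H"] False by (simp add: \<Phi>_def of_nat_diff algebra_simps add_divide_distrib diff_divide_distrib)
      ultimately show ?thesis by simp
    qed
  qed
  have "(\<lambda>N. C / real N + B * (real (l N) / real N)) \<longlonglongrightarrow> 0 + B * 0"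
    by (intro tendsto_intros l lim_const_over_n)
  then have "\<forall>\<^sub>F N in sequentially. C / real N + B * (real (l N) / real N) < a / 2"
    using \<open>0 < a\<close> by (intro order_tendstoD) auto
  then show "\<forall>\<^sub>F N in sequentially. S N / real N < a"
    using eventually_ge_at_top[of "max 1 N0"]
  proof eventually_elim
    case (elim N)
    then have "S N / real N \<le> (C + a / 2 * real N + B * real (l N)) / real N"
      using \<Phi>[of N] by (intro divide_right_mono) (auto simp: \<Phi>_def)
    also have "\<dots> = C / real N + B * (real (l N) / real N) + a / 2"
      using elim by (simp add: field_simps)
    finally show ?case using elim(1) by linarith
  qed
qed

lemma cesaro_mean_null:
  fixes r :: "nat \<Rightarrow> real"
  assumes "\<And>d. 0 \<le> r d" "r \<longlonglongrightarrow> 0"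
  shows "(\<lambda>H. (\<Sum>d<H. r d) / real H) \<longlonglongrightarrow> 0"
proof (rule sublinear_of_slow_increments[where l="\<lambda>_. 0"])
  fix \<epsilon> :: real assume "0 < \<epsilon>"
  then obtain N0 where "\<And>N. N0 \<le> N \<Longrightarrow> r N < \<epsilon>"
    using order_tendstoD(2)[OF assms(2)] by (auto simp: eventually_sequentially)
  then have "\<forall>N\<ge>N0. (\<Sum>d<N + 1. r d) \<le> (\<Sum>d<N. r d) + \<epsilon> * real 1 + 0 * (real 0 - real 0)"
    by (auto intro: less_imp_le)
  then show "\<exists>H\<ge>1. \<exists>N0 B. \<forall>N\<ge>N0.
      (\<Sum>d<N + H. r d) \<le> (\<Sum>d<N. r d) + \<epsilon> * real H + B * (real 0 - real 0)"
    by (intro exI[of _ 1] conjI exI[of _ N0] exI[of _ 0]) auto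
qed (auto intro: sum_nonneg assms)

section \<open>Square-integrable functions\<close>

lemma norm_mult_le_sum_squares:
  fixes a b :: complex
  shows "norm (a * b) \<le> (norm a)\<^sup>2 + (norm b)\<^sup>2"
proof -
  have "0 \<le> norm a * norm b" by simp
  then show ?thesis using sum_squares_bound[of "norm a" "norm b"] unfolding norm_mult by linarith
qed

lemma borel_measurable_cnj [measurable]:
  "f \<in> borel_measurable M \<Longrightarrow> (\<lambda>x. cnj (f x)) \<in> borel_measurable M"
  by (rule measurable_compose[OF _ borel_measurable_continuous_onI]) (auto intro: continuous_intros)

lemma L2_borel: "f \<in> L2 M \<Longrightarrow> f \<in> borel_measurable M"
  by (simp add: L2_def)

lemma L2_mult_integrable:
  assumes "f \<in> L2 M" "g \<in> L2 M"
  shows "integrable M (\<lambda>x. f x * g x)"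
proof (rule Bochner_Integration.integrable_bound)
  show "integrable M (\<lambda>x. (norm (f x))\<^sup>2 + (norm (g x))\<^sup>2)"
    using assms by (auto simp: L2_def)
  show "AE x in M. norm (f x * g x) \<le> norm ((norm (f x))\<^sup>2 + (norm (g x))\<^sup>2)"
    by (intro AE_I2) (use norm_mult_le_sum_squares in auto)
qed (use assms in \<open>auto simp: L2_def\<close>)

lemma L2_cnj: "f \<in> L2 M \<Longrightarrow> (\<lambda>x. cnj (f x)) \<in> L2 M"
  by (auto simp: L2_def)

lemma L2_add:
  assumes "f \<in> L2 M" "g \<in> L2 M"
  shows "(\<lambda>x. f x + g x) \<in> L2 M"
proof -
  have "integrable M (\<lambda>x. (norm (f x + g x))\<^sup>2)"
  proof (rule Bochner_Integration.integrable_bound)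
    show "integrable M (\<lambda>x. 2 * (norm (f x))\<^sup>2 + 2 * (norm (g x))\<^sup>2)"
      using assms by (auto simp: L2_def)
    have "(norm (f x + g x))\<^sup>2 \<le> 2 * (norm (f x))\<^sup>2 + 2 * (norm (g x))\<^sup>2" for x
    proof -
      have "(norm (f x + g x))\<^sup>2 \<le> (norm (f x) + norm (g x))\<^sup>2"
        by (intro power_mono norm_triangle_ineq) auto
      also have "\<dots> \<le> 2 * (norm (f x))\<^sup>2 + 2 * (norm (g x))\<^sup>2"
        using sum_squares_bound[of "norm (f x)" "norm (g x)"] by (simp add: power2_sum)
      finally show ?thesis .
    qed
    then show "AE x in M. norm ((norm (f x + g x))\<^sup>2) \<le> norm (2 * (norm (f x))\<^sup>2 + 2 * (norm (g x))\<^sup>2)"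
      by (intro AE_I2) auto
  qed (use assms in \<open>auto simp: L2_def\<close>)
  then show ?thesis using assms by (auto simp: L2_def)
qed

lemma L2_cmult: "f \<in> L2 M \<Longrightarrow> (\<lambda>x. a * f x) \<in> L2 M"
  by (auto simp: L2_def norm_mult power_mult_distrib)

lemma L2_diff: "f \<in> L2 M \<Longrightarrow> g \<in> L2 M \<Longrightarrow> (\<lambda>x. f x - g x) \<in> L2 M"
  using L2_add[of f M "\<lambda>x. (-1) * g x"] L2_cmult[of g M "-1"] by simp

lemma L2_zero: "(\<lambda>x. 0) \<in> L2 M"
  by (auto simp: L2_def)

lemma L2_sum: "(\<And>i. i \<in> I \<Longrightarrow> F i \<in> L2 M) \<Longrightarrow> (\<lambda>x. \<Sum>i\<in>I. F i x) \<in> L2 M"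
  by (induction I rule: infinite_finite_induct) (auto intro: L2_zero L2_add)

lemma L2_norm_nonneg [simp]: "0 \<le> L2_norm M f"
  by (simp add: L2_norm_def)

lemma L2_norm_zero [simp]: "L2_norm M (\<lambda>x. 0) = 0"
  by (simp add: L2_norm_def)

lemma L2_norm_power2: "(L2_norm M f)\<^sup>2 = (\<integral>x. (norm (f x))\<^sup>2 \<partial>M)"
  by (simp add: L2_norm_def)

lemma L2_norm_cmult: "L2_norm M (\<lambda>x. a * f x) = norm a * L2_norm M f"
  by (simp add: L2_norm_def norm_mult power_mult_distrib real_sqrt_mult)

lemma L2_norm_cong_AE:
  assumes "f \<in> borel_measurable M" "g \<in> borel_measurable M" "AE x in M. f x = g x"
  shows "L2_norm M f = L2_norm M g"
  unfolding L2_norm_def using assms by (intro arg_cong[where f=sqrt] integral_cong_AE) auto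

lemma L2_Cauchy_Schwarz:
  assumes f: "f \<in> L2 M" and g: "g \<in> L2 M"
  shows "norm (\<integral>x. f x * g x \<partial>M) \<le> L2_norm M f * L2_norm M g"
proof -
  have [measurable]: "f \<in> borel_measurable M" "g \<in> borel_measurable M"
    using f g by (auto simp: L2_def)
  have int: "integrable M (\<lambda>x. norm (f x) * norm (g x))"
    using integrable_norm[OF L2_mult_integrable[OF f g]] by (simp add: norm_mult)
  let ?I = "\<integral>x. norm (f x) * norm (g x) \<partial>M"
  have "(\<integral>\<^sup>+x. ennreal (norm (f x)) * ennreal (norm (g x)) \<partial>M)\<^sup>2 \<le>
      (\<integral>\<^sup>+x. (ennreal (norm (f x)))\<^sup>2 \<partial>M) * (\<integral>\<^sup>+x. (ennreal (norm (g x)))\<^sup>2 \<partial>M)"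
    by (rule Cauchy_Schwarz_nn_integral) auto
  moreover have "(\<integral>\<^sup>+x. ennreal (norm (f x)) * ennreal (norm (g x)) \<partial>M) = ennreal ?I"
    by (subst nn_integral_eq_integral[OF int, symmetric]) (auto simp: ennreal_mult)
  moreover have "(\<integral>\<^sup>+x. (ennreal (norm (h x)))\<^sup>2 \<partial>M) = ennreal ((L2_norm M h)\<^sup>2)" if "h \<in> L2 M" for h
    unfolding L2_norm_power2
    by (subst nn_integral_eq_integral[symmetric]) (use that in \<open>auto simp: L2_def ennreal_power\<close>)
  ultimately have "ennreal (?I\<^sup>2) \<le> ennreal ((L2_norm M f)\<^sup>2 * (L2_norm M g)\<^sup>2)"
    using f g by (simp add: ennreal_power ennreal_mult)
  then have "?I\<^sup>2 \<le> (L2_norm M f * L2_norm M g)\<^sup>2"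
    by (simp add: power_mult_distrib)
  then have "?I \<le> L2_norm M f * L2_norm M g"
    by (rule power2_le_imp_le) simp
  moreover have "norm (\<integral>x. f x * g x \<partial>M) \<le> ?I"
    using integral_norm_bound[of M "\<lambda>x. f x * g x"] by (simp add: norm_mult)
  ultimately show ?thesis by linarith
qed

lemma L2_norm_add_power2:
  assumes f: "f \<in> L2 M" and g: "g \<in> L2 M"
  shows "(L2_norm M (\<lambda>x. f x + g x))\<^sup>2 =
         (L2_norm M f)\<^sup>2 + (L2_norm M g)\<^sup>2 + 2 * Re (\<integral>x. g x * cnj (f x) \<partial>M)"
proof -
  have int: "integrable M (\<lambda>x. g x * cnj (f x))"
    by (intro L2_mult_integrable L2_cnj f g)
  define P where "P x = Re (g x * cnj (f x))" for x
  have P: "integrable M P" "(\<integral>x. P x \<partial>M) = Re (\<integral>x. g x * cnj (f x) \<partial>M)"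
    unfolding P_def by (rule integrable_Re[OF int], rule integral_Re[OF int])
  have "(norm (f x + g x))\<^sup>2 = (norm (f x))\<^sup>2 + (norm (g x))\<^sup>2 + 2 * P x" for x
    unfolding cmod_power2 P_def by (simp add: power2_eq_square algebra_simps)
  then show ?thesis
    using f g P(1) unfolding L2_norm_power2 L2_def P(2)[symmetric] by simp
qed

lemma L2_norm_triangle:
  assumes f: "f \<in> L2 M" and g: "g \<in> L2 M"
  shows "L2_norm M (\<lambda>x. f x + g x) \<le> L2_norm M f + L2_norm M g"
proof (rule power2_le_imp_le)
  have "Re (\<integral>x. g x * cnj (f x) \<partial>M) \<le> L2_norm M g * L2_norm M (\<lambda>x. cnj (f x))"
    using L2_Cauchy_Schwarz[OF g L2_cnj[OF f]] complex_Re_le_cmod order_trans by blast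
  then show "(L2_norm M (\<lambda>x. f x + g x))\<^sup>2 \<le> (L2_norm M f + L2_norm M g)\<^sup>2"
    unfolding L2_norm_add_power2[OF f g] by (simp add: L2_norm_def[of M "\<lambda>x. cnj (f x)"] flip: L2_norm_def) (simp add: power2_sum mult.commute)
qed simp

lemma L2_norm_triangle_diff:
  assumes f: "f \<in> L2 M" and g: "g \<in> L2 M"
  shows "L2_norm M (\<lambda>x. f x - g x) \<le> L2_norm M f + L2_norm M g"
  using L2_norm_triangle[OF f L2_cmult[OF g, of "-1"]] L2_norm_cmult[of M "-1" g] by simp

lemma L2_norm_sum_le:
  "(\<And>i. i \<in> I \<Longrightarrow> F i \<in> L2 M) \<Longrightarrow> L2_norm M (\<lambda>x. \<Sum>i\<in>I. F i x) \<le> (\<Sum>i\<in>I. L2_norm M (F i))"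
proof (induction I rule: infinite_finite_induct)
  case (insert i I)
  have "L2_norm M (\<lambda>x. F i x + (\<Sum>j\<in>I. F j x)) \<le> L2_norm M (F i) + L2_norm M (\<lambda>x. \<Sum>j\<in>I. F j x)"
    using insert by (intro L2_norm_triangle L2_sum) auto
  then show ?case using insert by force
qed auto

lemma L2_norm_zero_imp_AE:
  assumes "f \<in> L2 M" "L2_norm M f = 0"
  shows "AE x in M. f x = 0"
proof -
  have "AE x in M. (norm (f x))\<^sup>2 = 0"
    using assms by (subst integral_nonneg_eq_0_iff_AE[symmetric]) (auto simp: L2_def L2_norm_def)
  then show ?thesis by simp
qed

section \<open>Essentially bounded functions\<close>

lemma Linfty_borel: "f \<in> Linfty M \<Longrightarrow> f \<in> borel_measurable M"
  by (simp add: Linfty_def)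

lemma LinftyE:
  assumes "f \<in> Linfty M"
  obtains c where "0 \<le> c" "AE x in M. norm (f x) \<le> c"
proof -
  obtain c where "AE x in M. norm (f x) \<le> c" using assms by (auto simp: Linfty_def)
  then have "AE x in M. norm (f x) \<le> max c 0" by eventually_elim auto
  then show ?thesis by (intro that[of "max c 0"]) auto
qed

lemma LinftyI: "f \<in> borel_measurable M \<Longrightarrow> AE x in M. norm (f x) \<le> c \<Longrightarrow> f \<in> Linfty M"
  by (auto simp: Linfty_def)

lemma Linfty_const: "(\<lambda>x. c) \<in> Linfty M"
  by (rule LinftyI[of _ _ "norm c"]) auto

lemma Linfty_cnj: "f \<in> Linfty M \<Longrightarrow> (\<lambda>x. cnj (f x)) \<in> Linfty M"
  by (auto simp: Linfty_def)

lemma Linfty_mult: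
  assumes "f \<in> Linfty M" "g \<in> Linfty M"
  shows "(\<lambda>x. f x * g x) \<in> Linfty M"
proof -
  obtain a where "0 \<le> a" and a: "AE x in M. norm (f x) \<le> a" using assms(1) by (rule LinftyE)
  obtain b where b: "AE x in M. norm (g x) \<le> b" using assms(2) by (rule LinftyE)
  from a b have "AE x in M. norm (f x * g x) \<le> a * b"
    by eventually_elim (use \<open>0 \<le> a\<close> in \<open>auto simp: norm_mult intro: mult_mono\<close>)
  then show ?thesis using assms[THEN Linfty_borel] by (intro LinftyI) auto
qed

lemma Linfty_diff:
  assumes "f \<in> Linfty M" "g \<in> Linfty M"
  shows "(\<lambda>x. f x - g x) \<in> Linfty M"
proof -
  obtain a where a: "AE x in M. norm (f x) \<le> a" using assms(1) by (rule LinftyE)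
  obtain b where b: "AE x in M. norm (g x) \<le> b" using assms(2) by (rule LinftyE)
  from a b have "AE x in M. norm (f x - g x) \<le> a + b"
    by eventually_elim (rule order_trans[OF norm_triangle_ineq4 add_mono])
  then show ?thesis using assms[THEN Linfty_borel] by (intro LinftyI) auto
qed

lemma (in prob_space) Linfty_L2: "f \<in> Linfty M \<Longrightarrow> f \<in> L2 M"
proof -
  assume f: "f \<in> Linfty M"
  then obtain c where "0 \<le> c" and c: "AE x in M. norm (f x) \<le> c" by (rule LinftyE)
  from c have "AE x in M. norm ((norm (f x))\<^sup>2) \<le> c\<^sup>2"
    by eventually_elim (auto intro: power_mono)
  then have "integrable M (\<lambda>x. (norm (f x))\<^sup>2)"
    using Linfty_borel[OF f] by (intro integrable_const_bound[of _ "c\<^sup>2"]) auto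
  then show ?thesis using Linfty_borel[OF f] by (simp add: L2_def)
qed

lemma (in prob_space) L2_norm_le_bound:
  assumes "f \<in> borel_measurable M" "0 \<le> c" "AE x in M. norm (f x) \<le> c"
  shows "L2_norm M f \<le> c"
proof (rule power2_le_imp_le)
  have "f \<in> L2 M" using assms by (intro Linfty_L2 LinftyI)
  moreover from assms(3) have "AE x in M. (norm (f x))\<^sup>2 \<le> c\<^sup>2"
    by eventually_elim (auto intro: power_mono)
  ultimately have "(\<integral>x. (norm (f x))\<^sup>2 \<partial>M) \<le> c\<^sup>2"
    by (intro integral_le_const) (auto simp: L2_def)
  then show "(L2_norm M f)\<^sup>2 \<le> c\<^sup>2" by (simp add: L2_norm_power2)
qed fact

lemma (in prob_space) L2_const: "(\<lambda>x. c) \<in> L2 M"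
  by (intro Linfty_L2 Linfty_const)

lemma (in prob_space) L2_integrable: "f \<in> L2 M \<Longrightarrow> integrable M f"
  using L2_mult_integrable[OF _ L2_const[of 1]] by simp

lemma (in prob_space) norm_integral_le_L2_norm:
  assumes "f \<in> L2 M"
  shows "norm (\<integral>x. f x \<partial>M) \<le> L2_norm M f"
proof -
  have "L2_norm M (\<lambda>x. 1) = 1" by (simp add: L2_norm_def prob_space)
  then show ?thesis using L2_Cauchy_Schwarz[OF assms L2_const[of 1]] by simp
qed

text \<open>
  Truncate \<open>f\<close> at height \<open>R\<close>; the error tends to zero by dominated convergence.
\<close>
lemma L2_Linfty_dense:
  assumes f: "f \<in> L2 M" and "0 < \<epsilon>"
  shows "\<exists>h\<in>Linfty M. h \<in> L2 M \<and> L2_norm M (\<lambda>x. f x - h x) < \<epsilon>"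
proof -
  have [measurable]: "f \<in> borel_measurable M" using f by (rule L2_borel)
  define h where "h R x = (if norm (f x) \<le> real R then f x else 0)" for R :: nat and x
  have [measurable]: "h R \<in> borel_measurable M" for R unfolding h_def by measurable
  have "(\<lambda>R. \<integral>x. (norm (f x - h R x))\<^sup>2 \<partial>M) \<longlonglongrightarrow> (\<integral>x. 0 \<partial>M)"
  proof (rule integral_dominated_convergence[where w="\<lambda>x. (norm (f x))\<^sup>2"])
    show "integrable M (\<lambda>x. (norm (f x))\<^sup>2)" using f by (simp add: L2_def)
    show "AE x in M. (\<lambda>R. (norm (f x - h R x))\<^sup>2) \<longlonglongrightarrow> 0"
    proof (intro AE_I2 tendsto_eventually)
      fix x
      obtain R0 where "norm (f x) \<le> real R0" using real_arch_simple by blast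
      then show "\<forall>\<^sub>F R in sequentially. (norm (f x - h R x))\<^sup>2 = 0"
        by (intro eventually_sequentiallyI[of R0]) (auto simp: h_def)
    qed
  qed (auto simp: h_def)
  then have "(\<lambda>R. L2_norm M (\<lambda>x. f x - h R x)) \<longlonglongrightarrow> sqrt 0"
    unfolding L2_norm_def by (intro tendsto_real_sqrt) simp
  then have "\<forall>\<^sub>F R in sequentially. L2_norm M (\<lambda>x. f x - h R x) < \<epsilon>"
    using \<open>0 < \<epsilon>\<close> by (intro order_tendstoD) auto
  then obtain R where R: "L2_norm M (\<lambda>x. f x - h R x) < \<epsilon>"
    by (auto simp: eventually_sequentially)
  have "h R \<in> Linfty M" by (rule LinftyI[of _ _ "real R"]) (auto simp: h_def)
  moreover have "h R \<in> L2 M"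
  proof -
    have "integrable M (\<lambda>x. (norm (h R x))\<^sup>2)"
      by (rule Bochner_Integration.integrable_bound[of _ "\<lambda>x. (norm (f x))\<^sup>2"])
        (use f in \<open>auto simp: L2_def h_def\<close>)
    then show ?thesis by (simp add: L2_def)
  qed
  ultimately show ?thesis using R by blast
qed

section \<open>Iterates of a measure-preserving map\<close>

locale measure_preserving = prob_space M for M :: "'a measure" +
  fixes T :: "'a \<Rightarrow> 'a"
  assumes T_measurable: "T \<in> M \<rightarrow>\<^sub>M M" and T_distr: "distr M M T = M"
begin

lemma iter_measurable [measurable]: "T ^^ n \<in> M \<rightarrow>\<^sub>M M"
proof (induction n)
  case (Suc n)
  then show ?case using T_measurable by (auto intro: measurable_comp)
qed (simp add: id_def)

lemma distr_iter: "distr M M (T ^^ n) = M"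
proof (induction n)
  case 0
  then show ?case by (simp add: id_def)
next
  case (Suc n)
  have "distr M M (T \<circ> T ^^ n) = distr (distr M M (T ^^ n)) M T"
    by (rule distr_distr[symmetric]) (auto intro: T_measurable iter_measurable)
  then show ?case using Suc T_distr by (simp only: funpow.simps)
qed

lemma integral_iter:
  fixes f :: "'a \<Rightarrow> 'b::{banach, second_countable_topology}"
  assumes "f \<in> borel_measurable M"
  shows "(\<integral>x. f ((T ^^ n) x) \<partial>M) = (\<integral>x. f x \<partial>M)"
  using integral_distr[OF iter_measurable assms, of n] by (simp add: distr_iter)

lemma AE_iter:
  assumes "AE x in M. P x"
  shows "AE x in M. P ((T ^^ n) x)"
proof (rule AE_distrD[OF iter_measurable])
  show "AE x in distr M M (T ^^ n). P x" using assms by (subst distr_iter)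
qed

lemma borel_measurable_iter:
  fixes f :: "'a \<Rightarrow> 'b::topological_space"
  shows "f \<in> borel_measurable M \<Longrightarrow> (\<lambda>x. f ((T ^^ n) x)) \<in> borel_measurable M"
  by (rule measurable_compose[OF iter_measurable])

lemma Linfty_iter:
  assumes "f \<in> Linfty M"
  shows "(\<lambda>x. f ((T ^^ n) x)) \<in> Linfty M"
proof -
  obtain c where "AE x in M. norm (f x) \<le> c" using assms by (rule LinftyE)
  then have "AE x in M. norm (f ((T ^^ n) x)) \<le> c" by (rule AE_iter)
  then show ?thesis by (intro LinftyI borel_measurable_iter Linfty_borel[OF assms])
qed

lemma L2_norm_iter:
  assumes "f \<in> borel_measurable M"
  shows "L2_norm M (\<lambda>x. f ((T ^^ n) x)) = L2_norm M f"
  unfolding L2_norm_def using integral_iter[of "\<lambda>x. (norm (f x))\<^sup>2" n] assms by simp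

lemma L2_iter:
  assumes "f \<in> L2 M"
  shows "(\<lambda>x. f ((T ^^ n) x)) \<in> L2 M"
proof -
  have "integrable M (\<lambda>x. (norm (f ((T ^^ n) x)))\<^sup>2)"
    using assms integrable_distr[OF iter_measurable[of n], where f="\<lambda>x. (norm (f x))\<^sup>2"]
    by (simp add: distr_iter L2_def)
  then show ?thesis using borel_measurable_iter assms by (auto simp: L2_def)
qed

lemma iter_commute: "(T ^^ m) ((T ^^ n) x) = (T ^^ n) ((T ^^ m) x)"
  by (metis add.commute comp_apply funpow_add)

lemma iter_add: "(T ^^ (m + n)) x = (T ^^ m) ((T ^^ n) x)"
  by (simp add: funpow_add)

lemma iter_add_swapped: "(T ^^ (m + n)) x = (T ^^ n) ((T ^^ m) x)"
  by (simp only: iter_add iter_commute[of m n])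

lemma koopman_nat: "koopman M T (int n) f x = f ((T ^^ n) x)"
  by (simp add: koopman_def int_iter_def)

lemma L2_norm_average_minus_const:
  assumes "1 \<le> N"
  shows "L2_norm M (\<lambda>x. (\<Sum>n=1..N. F n x) / of_nat N - c) = L2_norm M (\<lambda>x. \<Sum>n=1..N. F n x - c) / real N"
proof -
  have "(\<Sum>n=1..N. F n x) / of_nat N - c = (1 / of_nat N) * (\<Sum>n=1..N. F n x - c)" for x
    using assms by (simp add: sum_subtractf diff_divide_distrib)
  then show ?thesis by (simp only: L2_norm_cmult) (simp add: norm_divide)
qed

lemma jointly_ergodic_log_iff:
  "jointly_ergodic M T (\<lambda>n. int n) (\<lambda>n. int n + \<lfloor>log 2 (real n)\<rfloor>) \<longleftrightarrow>
    (\<forall>f1\<in>Linfty M. \<forall>f2\<in>Linfty M. (\<lambda>N. L2_norm M (\<lambda>x. \<Sum>n=1..N.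
        f1 ((T ^^ n) x) * f2 ((T ^^ (n + dyadic_level n)) x) - (\<integral>y. f1 y \<partial>M) * (\<integral>y. f2 y \<partial>M)) / real N)
      \<longlonglongrightarrow> 0)"
  unfolding jointly_ergodic_def
proof (intro ball_cong refl tendsto_cong, rule eventually_sequentiallyI[of 1])
  fix f1 f2 :: "'a \<Rightarrow> complex" and N :: nat assume "1 \<le> N"
  have "(\<Sum>n=1..N. koopman M T (int n) f1 x * koopman M T (int n + \<lfloor>log 2 (real n)\<rfloor>) f2 x) =
      (\<Sum>n=1..N. f1 ((T ^^ n) x) * f2 ((T ^^ (n + dyadic_level n)) x))" for x
    by (intro sum.cong refl) (simp add: int_dyadic_level koopman_nat flip: of_nat_add)
  then show "L2_norm M (\<lambda>x. (\<Sum>n=1..N. koopman M T (int n) f1 x *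
        koopman M T (int n + \<lfloor>log 2 (real n)\<rfloor>) f2 x) / of_nat N - (\<integral>y. f1 y \<partial>M) * (\<integral>y. f2 y \<partial>M)) =
      L2_norm M (\<lambda>x. \<Sum>n=1..N. f1 ((T ^^ n) x) * f2 ((T ^^ (n + dyadic_level n)) x) -
        (\<integral>y. f1 y \<partial>M) * (\<integral>y. f2 y \<partial>M)) / real N"
    using L2_norm_average_minus_const[OF \<open>1 \<le> N\<close>] by simp
qed

lemma ergodic_along_log_iff:
  "ergodic_along M T (\<lambda>n. \<lfloor>log 2 (real n)\<rfloor>) \<longleftrightarrow>
    (\<forall>f\<in>Linfty M. (\<lambda>N. L2_norm M (\<lambda>x. \<Sum>n=1..N.
        f ((T ^^ dyadic_level n) x) - (\<integral>y. f y \<partial>M)) / real N) \<longlonglongrightarrow> 0)"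
  unfolding ergodic_along_def
proof (intro ball_cong refl tendsto_cong, rule eventually_sequentiallyI[of 1])
  fix f :: "'a \<Rightarrow> complex" and N :: nat assume "1 \<le> N"
  have "(\<Sum>n=1..N. koopman M T \<lfloor>log 2 (real n)\<rfloor> f x) = (\<Sum>n=1..N. f ((T ^^ dyadic_level n) x))" for x
    by (intro sum.cong refl) (simp add: int_dyadic_level koopman_nat)
  then show "L2_norm M (\<lambda>x. (\<Sum>n=1..N. koopman M T \<lfloor>log 2 (real n)\<rfloor> f x) / of_nat N - (\<integral>y. f y \<partial>M)) =
      L2_norm M (\<lambda>x. \<Sum>n=1..N. f ((T ^^ dyadic_level n) x) - (\<integral>y. f y \<partial>M)) / real N"
    using L2_norm_average_minus_const[OF \<open>1 \<le> N\<close>] by simp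
qed

section \<open>Mixing implies joint ergodicity\<close>

lemma correlation_iter:
  assumes g: "g \<in> L2 M" and "h \<le> m"
  shows "(\<integral>x. g ((T ^^ m) x) * cnj (g ((T ^^ h) x)) \<partial>M) = (\<integral>x. g ((T ^^ (m - h)) x) * cnj (g x) \<partial>M)"
proof -
  have [measurable]: "g \<in> borel_measurable M" by (rule L2_borel[OF g])
  have "(T ^^ m) x = (T ^^ (m - h)) ((T ^^ h) x)" for x
    using \<open>h \<le> m\<close> by (simp flip: iter_add)
  then show ?thesis
    using integral_iter[of "\<lambda>x. g ((T ^^ (m - h)) x) * cnj (g x)" h] by simp
qed

text \<open>
  An inequality of van der Corput type: an ergodic sum is small as soon as the autocorrelations of
  \<open>g\<close> are small on average.  The step from \<open>H\<close> to \<open>H + 1\<close> expands the square.  By invariance the cross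
  terms are the autocorrelations at the lags \<open>1, \<dots>, H\<close>, and the new diagonal term is the one at lag
  zero.  The bound holds for each \<open>g\<close> and \<open>H\<close> without error term, so \<open>H\<close> may be fixed while \<open>g\<close> varies.
\<close>
lemma L2_norm_ergodic_sum_le:
  assumes g: "g \<in> L2 M"
  shows "(L2_norm M (\<lambda>x. \<Sum>h<H. g ((T ^^ h) x)))\<^sup>2
           \<le> 2 * real H * (\<Sum>d<H. norm (\<integral>x. g ((T ^^ d) x) * cnj (g x) \<partial>M))"
proof (induction H)
  case 0
  then show ?case by simp
next
  case (Suc H)
  define \<rho> where "\<rho> d = norm (\<integral>x. g ((T ^^ d) x) * cnj (g x) \<partial>M)" for d
  define V where "V x = (\<Sum>h<H. g ((T ^^ h) x))" for x
  define w where "w x = g ((T ^^ H) x)" for x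
  have V: "V \<in> L2 M" unfolding V_def by (intro L2_sum L2_iter g)
  have w: "w \<in> L2 M" unfolding w_def by (intro L2_iter g)
  have "(L2_norm M w)\<^sup>2 = (L2_norm M g)\<^sup>2"
    unfolding w_def using L2_norm_iter[OF L2_borel[OF g]] by simp
  also have "\<dots> = \<rho> 0"
  proof -
    have "complex_of_real ((norm (g x))\<^sup>2) = g x * cnj (g x)" for x
      by (rule complex_norm_square)
    then have "(\<integral>x. g x * cnj (g x) \<partial>M) = complex_of_real (\<integral>x. (norm (g x))\<^sup>2 \<partial>M)"
      by (simp flip: integral_complex_of_real)
    then show ?thesis by (simp add: \<rho>_def L2_norm_power2)
  qed
  finally have normw: "(L2_norm M w)\<^sup>2 = \<rho> 0" .
  have "(\<integral>x. w x * cnj (V x) \<partial>M) = (\<Sum>h<H. \<integral>x. w x * cnj (g ((T ^^ h) x)) \<partial>M)"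
    unfolding V_def cnj_sum sum_distrib_left
    by (intro Bochner_Integration.integral_sum L2_mult_integrable L2_cnj L2_iter w g)
  also have "norm \<dots> \<le> (\<Sum>h<H. \<rho> (H - h))"
    unfolding w_def \<rho>_def by (rule sum_norm_le) (simp add: correlation_iter[OF g])
  also have "\<dots> = (\<Sum>h<H. \<rho> (Suc h))"
    by (subst sum.nat_diff_reindex[of "\<lambda>h. \<rho> (Suc h)", symmetric]) (auto intro!: sum.cong simp: Suc_diff_Suc)
  finally have cross: "Re (\<integral>x. w x * cnj (V x) \<partial>M) \<le> (\<Sum>h<H. \<rho> (Suc h))"
    using complex_Re_le_cmod order_trans by blast
  have "0 \<le> \<rho> 0" by (simp add: \<rho>_def)
  have "(L2_norm M (\<lambda>x. \<Sum>h<Suc H. g ((T ^^ h) x)))\<^sup>2 = (L2_norm M (\<lambda>x. V x + w x))\<^sup>2"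
    by (simp add: V_def w_def)
  also have "\<dots> = (L2_norm M V)\<^sup>2 + \<rho> 0 + 2 * Re (\<integral>x. w x * cnj (V x) \<partial>M)"
    unfolding L2_norm_add_power2[OF V w] normw ..
  also have "\<dots> \<le> 2 * real H * (\<Sum>d<H. \<rho> d) + 2 * \<rho> 0 + 2 * (\<Sum>h<H. \<rho> (Suc h))"
    using Suc.IH[folded \<rho>_def V_def] cross \<open>0 \<le> \<rho> 0\<close> by linarith
  also have "\<dots> = 2 * real H * (\<Sum>d<H. \<rho> d) + 2 * (\<Sum>d<Suc H. \<rho> d)"
    by (subst sum.lessThan_Suc_shift) simp
  also have "\<dots> \<le> 2 * real H * (\<Sum>d<Suc H. \<rho> d) + 2 * (\<Sum>d<Suc H. \<rho> d)"
    by (intro add_mono mult_left_mono) (auto simp: \<rho>_def)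
  finally show ?case by (simp add: \<rho>_def algebra_simps)
qed

lemma mixing_Linfty:
  assumes "mixing M T" "f \<in> Linfty M" "g \<in> Linfty M"
  shows "(\<lambda>n. \<integral>x. f x * g ((T ^^ n) x) \<partial>M) \<longlonglongrightarrow> (\<integral>x. f x \<partial>M) * (\<integral>x. g x \<partial>M)"
  using assms Linfty_L2 unfolding mixing_def koopman_nat by blast

text \<open>
  The lag \<open>d\<close> is fixed while \<open>k\<close> grows.  The main term of \<open>T\<^sup>d G\<^sub>k\<close> times the conjugate of \<open>G\<^sub>k\<close> is the
  product of a function built from \<open>f1\<close> alone with the \<open>k\<close>-th translate of one built from \<open>f2\<close> alone,
  so mixing decouples the two; it also evaluates the terms that come from subtracting \<open>c\<close>.
\<close>
lemma product_correlation_tendsto: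
  assumes mix: "mixing M T" and f1: "f1 \<in> Linfty M" and f2: "f2 \<in> Linfty M"
  defines "c \<equiv> (\<integral>x. f1 x \<partial>M) * (\<integral>x. f2 x \<partial>M)"
  defines "G \<equiv> \<lambda>k x. f1 x * f2 ((T ^^ k) x) - c"
  shows "(\<lambda>k. \<integral>x. G k ((T ^^ d) x) * cnj (G k x) \<partial>M) \<longlonglongrightarrow>
    (\<integral>x. f1 ((T ^^ d) x) * cnj (f1 x) \<partial>M) * (\<integral>x. f2 ((T ^^ d) x) * cnj (f2 x) \<partial>M) - c * cnj c"
proof -
  define F1 where "F1 x = f1 ((T ^^ d) x) * cnj (f1 x)" for x
  define F2 where "F2 x = f2 ((T ^^ d) x) * cnj (f2 x)" for x
  define P where "P k x = f1 x * f2 ((T ^^ k) x)" for k x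
  have F: "F1 \<in> Linfty M" "F2 \<in> Linfty M"
    unfolding F1_def F2_def by (intro Linfty_mult Linfty_cnj Linfty_iter f1 f2)+
  have P: "P k \<in> Linfty M" for k
    unfolding P_def by (intro Linfty_mult Linfty_iter f1 f2)
  have limP: "(\<lambda>k. \<integral>x. P k x \<partial>M) \<longlonglongrightarrow> c"
    unfolding P_def c_def by (rule mixing_Linfty[OF mix f1 f2])
  have "(\<integral>x. G k ((T ^^ d) x) * cnj (G k x) \<partial>M) =
      (\<integral>x. F1 x * F2 ((T ^^ k) x) \<partial>M) - cnj c * (\<integral>x. P k x \<partial>M) - c * cnj (\<integral>x. P k x \<partial>M) + c * cnj c" for k
  proof -
    have int: "integrable M (\<lambda>x. F1 x * F2 ((T ^^ k) x))" "integrable M (\<lambda>x. P k ((T ^^ d) x))"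
        "integrable M (\<lambda>x. cnj (P k x))"
      by (intro L2_integrable Linfty_L2 Linfty_mult Linfty_iter Linfty_cnj F P)+
    have "G k ((T ^^ d) x) * cnj (G k x) =
        F1 x * F2 ((T ^^ k) x) - cnj c * P k ((T ^^ d) x) - c * cnj (P k x) + c * cnj c" for x
      unfolding G_def F1_def F2_def P_def by (simp add: iter_commute[of d k] algebra_simps)
    moreover have "(\<integral>x. P k ((T ^^ d) x) \<partial>M) = (\<integral>x. P k x \<partial>M)"
      by (rule integral_iter[OF Linfty_borel[OF P]])
    ultimately show ?thesis using int by (simp add: prob_space)
  qed
  moreover have "(\<lambda>k. (\<integral>x. F1 x * F2 ((T ^^ k) x) \<partial>M) - cnj c * (\<integral>x. P k x \<partial>M) - c * cnj (\<integral>x. P k x \<partial>M) + c * cnj c)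
      \<longlonglongrightarrow> (\<integral>x. F1 x \<partial>M) * (\<integral>x. F2 x \<partial>M) - cnj c * c - c * cnj c + c * cnj c"
    by (intro tendsto_intros limP mixing_Linfty[OF mix] F)
  ultimately show ?thesis unfolding F1_def F2_def by (simp add: mult.commute)
qed

lemma autocorrelation_tendsto:
  assumes mix: "mixing M T" and f: "f \<in> Linfty M"
  shows "(\<lambda>d. \<integral>x. f ((T ^^ d) x) * cnj (f x) \<partial>M) \<longlonglongrightarrow> (\<integral>x. f x \<partial>M) * cnj (\<integral>x. f x \<partial>M)"
  using mixing_Linfty[OF mix Linfty_cnj[OF f] f] by (simp add: mult.commute)

text \<open>
  Mixing is used twice.  As \<open>k \<rightarrow> \<infinity>\<close>, the correlation of \<open>G\<^sub>k\<close> at lag \<open>d\<close> tends to some \<open>\<gamma>\<^sub>d\<close>, and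
  as \<open>d \<rightarrow> \<infinity>\<close> in turn \<open>\<gamma>\<^sub>d \<rightarrow> 0\<close>.  So first choose \<open>H\<close> that makes the mean of the \<open>|\<gamma>\<^sub>d|\<close> with \<open>d < H\<close>
  small, and only then let \<open>k\<close> grow in the van der Corput inequality.
\<close>
lemma window_average_small:
  assumes mix: "mixing M T" and f1: "f1 \<in> Linfty M" and f2: "f2 \<in> Linfty M" and "0 < \<epsilon>"
  defines "c \<equiv> (\<integral>x. f1 x \<partial>M) * (\<integral>x. f2 x \<partial>M)"
  defines "G \<equiv> \<lambda>k x. f1 x * f2 ((T ^^ k) x) - c"
  shows "\<exists>H\<ge>1. \<forall>\<^sub>F k in sequentially. L2_norm M (\<lambda>x. \<Sum>h<H. G k ((T ^^ h) x)) \<le> \<epsilon> * real H"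
proof -
  define \<gamma> where "\<gamma> d = (\<integral>x. f1 ((T ^^ d) x) * cnj (f1 x) \<partial>M) * (\<integral>x. f2 ((T ^^ d) x) * cnj (f2 x) \<partial>M)
      - c * cnj c" for d
  have "\<gamma> \<longlonglongrightarrow> (\<integral>x. f1 x \<partial>M) * cnj (\<integral>x. f1 x \<partial>M) * ((\<integral>x. f2 x \<partial>M) * cnj (\<integral>x. f2 x \<partial>M)) - c * cnj c"
    unfolding \<gamma>_def by (intro tendsto_intros autocorrelation_tendsto mix f1 f2)
  then have "\<gamma> \<longlonglongrightarrow> 0" by (simp add: c_def algebra_simps)
  then have "(\<lambda>H. (\<Sum>d<H. norm (\<gamma> d)) / real H) \<longlonglongrightarrow> 0"
    by (intro cesaro_mean_null tendsto_norm_zero) auto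
  (* The bound is chosen so that the right-hand side 2 H (sum over d) of the van der Corput
     inequality falls below the square of \<epsilon> H. *)
  then have "\<forall>\<^sub>F H in sequentially. (\<Sum>d<H. norm (\<gamma> d)) / real H < \<epsilon>\<^sup>2 / 2"
    using \<open>0 < \<epsilon>\<close> by (intro order_tendstoD) auto
  then obtain H0 where "\<And>H. H0 \<le> H \<Longrightarrow> (\<Sum>d<H. norm (\<gamma> d)) / real H < \<epsilon>\<^sup>2 / 2"
    by (auto simp: eventually_sequentially)
  then obtain H where H: "1 \<le> H" "(\<Sum>d<H. norm (\<gamma> d)) / real H < \<epsilon>\<^sup>2 / 2"
    using max.cobounded1 max.cobounded2 by metis
  have G: "G k \<in> L2 M" for k
    unfolding G_def
    by (rule Linfty_L2[OF Linfty_diff[OF Linfty_mult[OF f1 Linfty_iter[OF f2]] Linfty_const]])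
  define R where "R k = 2 * real H * (\<Sum>d<H. norm (\<integral>x. G k ((T ^^ d) x) * cnj (G k x) \<partial>M))" for k
  have "R \<longlonglongrightarrow> 2 * real H * (\<Sum>d<H. norm (\<gamma> d))"
    unfolding R_def \<gamma>_def G_def c_def
    by (intro tendsto_intros product_correlation_tendsto mix f1 f2)
  moreover have "2 * real H * (\<Sum>d<H. norm (\<gamma> d)) < (\<epsilon> * real H)\<^sup>2"
    using H by (simp add: divide_simps power2_eq_square algebra_simps)
  ultimately have "\<forall>\<^sub>F k in sequentially. R k < (\<epsilon> * real H)\<^sup>2"
    by (rule order_tendstoD)
  then have "\<forall>\<^sub>F k in sequentially. L2_norm M (\<lambda>x. \<Sum>h<H. G k ((T ^^ h) x)) \<le> \<epsilon> * real H"
  proof eventually_elim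
    case (elim k)
    have "(L2_norm M (\<lambda>x. \<Sum>h<H. G k ((T ^^ h) x)))\<^sup>2 \<le> (\<epsilon> * real H)\<^sup>2"
      using L2_norm_ergodic_sum_le[OF G[of k], of H] elim by (simp add: R_def)
    then show ?case by (rule power2_le_imp_le) (use \<open>0 < \<epsilon>\<close> in simp)
  qed
  then show ?thesis using H(1) by blast
qed

text \<open>
  A window \<open>N + 1, \<dots>, N + H\<close> on which the dyadic level has a constant value \<open>k\<close> contributes the norm of
  an ergodic sum of \<open>G\<^sub>k\<close> of length \<open>H\<close>, because \<open>T\<close> acts isometrically.  That norm is at most \<open>\<epsilon> H\<close> once \<open>k\<close> is
  large.  A window on which the level jumps contributes at most a constant times \<open>H\<close>, which is paid for
  by the increase of the level.
\<close>
lemma mixing_imp_average_tendsto: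
  assumes mix: "mixing M T" and f1: "f1 \<in> Linfty M" and f2: "f2 \<in> Linfty M"
  defines "c \<equiv> (\<integral>x. f1 x \<partial>M) * (\<integral>x. f2 x \<partial>M)"
  shows "(\<lambda>N. L2_norm M (\<lambda>x. \<Sum>n=1..N. f1 ((T ^^ n) x) * f2 ((T ^^ (n + dyadic_level n)) x) - c) / real N)
            \<longlonglongrightarrow> 0"
proof -
  define G where "G k x = f1 x * f2 ((T ^^ k) x) - c" for k x
  define u where "u n x = G (dyadic_level n) ((T ^^ n) x)" for n x
  define S where "S N = L2_norm M (\<lambda>x. \<Sum>n=1..N. u n x)" for N
  have u_eq: "u n x = f1 ((T ^^ n) x) * f2 ((T ^^ (n + dyadic_level n)) x) - c" for n x
    by (simp only: u_def G_def iter_add_swapped)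
  have G: "G k \<in> L2 M" for k
    unfolding G_def
    by (rule Linfty_L2[OF Linfty_diff[OF Linfty_mult[OF f1 Linfty_iter[OF f2]] Linfty_const]])
  have u: "u n \<in> L2 M" for n unfolding u_def by (intro L2_iter G)
  obtain a where a: "0 \<le> a" "AE x in M. norm (f1 x) \<le> a" using f1 by (rule LinftyE)
  obtain b where b: "0 \<le> b" "AE x in M. norm (f2 x) \<le> b" using f2 by (rule LinftyE)
  define B where "B = a * b + norm c"
  have "0 \<le> B" unfolding B_def using a b by simp
  have uB: "L2_norm M (u n) \<le> B" for n
  proof -
    have "L2_norm M (G k) \<le> B" for k
    proof (rule L2_norm_le_bound[OF L2_borel[OF G] \<open>0 \<le> B\<close>])
      show "AE x in M. norm (G k x) \<le> B"
        using a(2) AE_iter[OF b(2), of k]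
      proof eventually_elim
        case (elim x)
        have "norm (G k x) \<le> norm (f1 x * f2 ((T ^^ k) x)) + norm c"
          unfolding G_def by (rule norm_triangle_ineq4)
        also have "\<dots> \<le> B" unfolding B_def norm_mult using elim a by (intro add_mono mult_mono) auto
        finally show ?case .
      qed
    qed
    then show ?thesis unfolding u_def using L2_norm_iter[OF L2_borel[OF G]] by simp
  qed
  have "(\<lambda>N. S N / real N) \<longlonglongrightarrow> 0"
  proof (rule sublinear_of_slow_increments[OF _ dyadic_level_sublinear])
    fix \<epsilon> :: real assume "0 < \<epsilon>"
    then obtain H where H: "1 \<le> H"
      and ev: "\<forall>\<^sub>F k in sequentially. L2_norm M (\<lambda>x. \<Sum>h<H. G k ((T ^^ h) x)) \<le> \<epsilon> * real H"
      using window_average_small[OF mix f1 f2] unfolding G_def c_def by blast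
    from ev obtain K where
      K: "\<And>k. K \<le> k \<Longrightarrow> L2_norm M (\<lambda>x. \<Sum>h<H. G k ((T ^^ h) x)) \<le> \<epsilon> * real H"
      by (auto simp: eventually_sequentially)
    have "S (N + H) \<le> S N + \<epsilon> * real H + B * real H * (real (dyadic_level (N + H)) - real (dyadic_level N))"
      if "2 ^ K \<le> N" for N
    proof -
      define W where "W = L2_norm M (\<lambda>x. \<Sum>h<H. u (Suc N + h) x)"
      have split: "(\<Sum>n=1..N + H. u n x) = (\<Sum>n=1..N. u n x) + (\<Sum>h<H. u (Suc N + h) x)" for x
        by (induction H) (simp_all add: add.assoc)
      have "S (N + H) \<le> S N + W"
        unfolding S_def W_def split by (intro L2_norm_triangle L2_sum u)
      moreover have "W \<le> \<epsilon> * real H + B * real H * (real (dyadic_level (N + H)) - real (dyadic_level N))"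
      proof (cases "dyadic_level (N + H) = dyadic_level N")
        case True
        have "dyadic_level (Suc N + h) = dyadic_level N" if "h < H" for h
          using monoD[OF dyadic_level_mono, of N "Suc N + h"] monoD[OF dyadic_level_mono, of "Suc N + h" "N + H"]
            that True by simp
        then have "(\<Sum>h<H. u (Suc N + h) x) = (\<Sum>h<H. G (dyadic_level N) ((T ^^ h) ((T ^^ Suc N) x)))" for x
          by (intro sum.cong refl) (simp only: u_def iter_add_swapped lessThan_iff)
        then have "W = L2_norm M (\<lambda>x. \<Sum>h<H. G (dyadic_level N) ((T ^^ h) ((T ^^ Suc N) x)))"
          unfolding W_def by simp
        also have "\<dots> = L2_norm M (\<lambda>x. \<Sum>h<H. G (dyadic_level N) ((T ^^ h) x))"
          by (rule L2_norm_iter[of "\<lambda>x. \<Sum>h<H. G (dyadic_level N) ((T ^^ h) x)"])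
            (intro L2_borel[OF L2_sum] L2_iter G)
        also have "\<dots> \<le> \<epsilon> * real H" by (intro K le_dyadic_level that)
        finally show ?thesis using True by simp
      next
        case False
        then have "dyadic_level N < dyadic_level (N + H)"
          using monoD[OF dyadic_level_mono, of N "N + H"] by simp
        then have "1 \<le> real (dyadic_level (N + H)) - real (dyadic_level N)" by linarith
        then have "B * real H * 1 \<le> B * real H * (real (dyadic_level (N + H)) - real (dyadic_level N))"
          using \<open>0 \<le> B\<close> by (intro mult_left_mono) auto
        moreover have "W \<le> (\<Sum>h<H. L2_norm M (u (Suc N + h)))"
          unfolding W_def by (intro L2_norm_sum_le u)
        moreover have "\<dots> \<le> B * real H"
          using sum_bounded_above[of "{..<H}" "\<lambda>h. L2_norm M (u (Suc N + h))" B] uB by (simp add: mult.commute)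
        moreover have "0 \<le> \<epsilon> * real H" using \<open>0 < \<epsilon>\<close> by simp
        ultimately show ?thesis by linarith
      qed
      ultimately show ?thesis by simp
    qed
    then show "\<exists>H\<ge>1. \<exists>N0 B. \<forall>N\<ge>N0. S (N + H) \<le>
        S N + \<epsilon> * real H + B * (real (dyadic_level (N + H)) - real (dyadic_level N))"
      using H by blast
  qed (simp add: S_def)
  then show ?thesis by (simp add: S_def u_eq)
qed

lemma mixing_imp_jointly_ergodic:
  assumes "mixing M T"
  shows "jointly_ergodic M T (\<lambda>n. int n) (\<lambda>n. int n + \<lfloor>log 2 (real n)\<rfloor>)"
  unfolding jointly_ergodic_log_iff using mixing_imp_average_tendsto[OF assms] by blast

section \<open>Joint ergodicity forces mixing\<close>

text \<open>
  Integrate the averages.  By invariance the factor \<open>T\<^sup>n\<close> disappears, and the \<open>n\<close>-th term becomes the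
  correlation of \<open>f1\<close> and \<open>f2\<close> at lag \<open>\<lfloor>log\<^sub>2 n\<rfloor>\<close>; this is constant on dyadic blocks, and so convergence of
  its averages is convergence of the correlations themselves.
\<close>
lemma jointly_ergodic_imp_mixing_Linfty:
  assumes je: "jointly_ergodic M T (\<lambda>n. int n) (\<lambda>n. int n + \<lfloor>log 2 (real n)\<rfloor>)"
    and f1: "f1 \<in> Linfty M" and f2: "f2 \<in> Linfty M"
  shows "(\<lambda>k. \<integral>x. f1 x * f2 ((T ^^ k) x) \<partial>M) \<longlonglongrightarrow> (\<integral>x. f1 x \<partial>M) * (\<integral>x. f2 x \<partial>M)"
proof -
  define c where "c = (\<integral>x. f1 x \<partial>M) * (\<integral>x. f2 x \<partial>M)"
  define u where "u n x = f1 ((T ^^ n) x) * f2 ((T ^^ (n + dyadic_level n)) x) - c" for n x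
  define S where "S N = L2_norm M (\<lambda>x. \<Sum>n=1..N. u n x)" for N
  define F where "F k = (\<integral>x. f1 x * f2 ((T ^^ k) x) \<partial>M) - c" for k
  have u: "u n \<in> L2 M" for n
    unfolding u_def
    by (rule Linfty_L2[OF Linfty_diff[OF Linfty_mult[OF Linfty_iter[OF f1] Linfty_iter[OF f2]] Linfty_const]])
  have lim: "(\<lambda>N. S N / real N) \<longlonglongrightarrow> 0"
    using je f1 f2 unfolding jointly_ergodic_log_iff S_def u_def c_def by blast
  have "2 ^ k * norm (F k) \<le> S (2 ^ Suc k - 1) + S (2 ^ k - 1)" for k
  proof -
    have int_u: "(\<integral>x. u n x \<partial>M) = F (dyadic_level n)" for n
    proof -
      have f: "(\<lambda>x. f1 x * f2 ((T ^^ dyadic_level n) x)) \<in> Linfty M"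
        by (intro Linfty_mult Linfty_iter f1 f2)
      have "(\<integral>x. f1 ((T ^^ n) x) * f2 ((T ^^ (n + dyadic_level n)) x) \<partial>M) =
          (\<integral>x. f1 x * f2 ((T ^^ dyadic_level n) x) \<partial>M)"
        using integral_iter[OF Linfty_borel[OF f], of n] by (simp only: iter_add_swapped)
      moreover have "integrable M (\<lambda>x. f1 ((T ^^ n) x) * f2 ((T ^^ (n + dyadic_level n)) x))"
        by (intro L2_integrable Linfty_L2 Linfty_mult Linfty_iter f1 f2)
      ultimately show ?thesis unfolding u_def F_def by (simp add: prob_space)
    qed
    have SF: "norm (\<Sum>n=1..N. F (dyadic_level n)) \<le> S N" for N
    proof -
      have "(\<Sum>n=1..N. F (dyadic_level n)) = (\<integral>x. (\<Sum>n=1..N. u n x) \<partial>M)"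
        unfolding int_u[symmetric] by (intro Bochner_Integration.integral_sum[symmetric] L2_integrable u)
      then show ?thesis unfolding S_def by (simp only: norm_integral_le_L2_norm L2_sum u)
    qed
    have "2 ^ k * F k = (\<Sum>n=1..2 ^ Suc k - 1. F (dyadic_level n)) - (\<Sum>n=1..2 ^ k - 1. F (dyadic_level n))"
      unfolding sum_dyadic_block by simp
    then have "norm (2 ^ k * F k) \<le> S (2 ^ Suc k - 1) + S (2 ^ k - 1)"
      by (metis norm_triangle_le_diff SF add_mono)
    then show ?thesis by (simp add: norm_mult norm_power)
  qed
  from sublinear_imp_dyadic_null[OF norm_ge_zero this lim]
  have "(\<lambda>k. norm (F k)) \<longlonglongrightarrow> 0" .
  then have "F \<longlonglongrightarrow> 0" by (rule tendsto_norm_zero_cancel)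
  then show ?thesis unfolding F_def c_def by (rule LIM_zero_cancel)
qed

lemma L2_covariance_bound:
  assumes f: "f \<in> L2 M" and g: "g \<in> L2 M"
  shows "norm ((\<integral>x. f x * g ((T ^^ n) x) \<partial>M) - (\<integral>x. f x \<partial>M) * (\<integral>x. g x \<partial>M)) \<le> 2 * (L2_norm M f * L2_norm M g)"
proof -
  have "norm (\<integral>x. f x * g ((T ^^ n) x) \<partial>M) \<le> L2_norm M f * L2_norm M g"
    using L2_Cauchy_Schwarz[OF f L2_iter[OF g]] L2_norm_iter[OF L2_borel[OF g]] by simp
  moreover have "norm ((\<integral>x. f x \<partial>M) * (\<integral>x. g x \<partial>M)) \<le> L2_norm M f * L2_norm M g"
    unfolding norm_mult by (intro mult_mono norm_integral_le_L2_norm f g) auto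
  ultimately show ?thesis using norm_triangle_ineq4 order_trans by (smt (verit))
qed

text \<open>
  The covariance is bilinear and bounded in the norms of its arguments, uniformly in the lag.  First
  \<open>f\<close> and then \<open>g\<close> is replaced by a bounded function; the tolerance \<open>b\<close> for \<open>g\<close> depends on the
  approximation of \<open>f\<close> already chosen.
\<close>
lemma mixing_of_Linfty:
  assumes bounded: "\<And>f g. f \<in> Linfty M \<Longrightarrow> g \<in> Linfty M \<Longrightarrow>
    (\<lambda>n. \<integral>x. f x * g ((T ^^ n) x) \<partial>M) \<longlonglongrightarrow> (\<integral>x. f x \<partial>M) * (\<integral>x. g x \<partial>M)"
  shows "mixing M T"
proof -
  define D where "D f g n = (\<integral>x. f x * g ((T ^^ n) x) \<partial>M) - (\<integral>x. f x \<partial>M) * (\<integral>x. g x \<partial>M)"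
    for f g :: "'a \<Rightarrow> complex" and n :: nat
  have bound: "norm (D f g n) \<le> 2 * (L2_norm M f * L2_norm M g)" if "f \<in> L2 M" "g \<in> L2 M" for f g n
    unfolding D_def by (rule L2_covariance_bound[OF that])
  have diff_left: "D (\<lambda>x. f x - h x) g n = D f g n - D h g n" if "f \<in> L2 M" "h \<in> L2 M" "g \<in> L2 M" for f g h n
  proof -
    have "integrable M (\<lambda>x. f x * g ((T ^^ n) x))" "integrable M (\<lambda>x. h x * g ((T ^^ n) x))"
        "integrable M f" "integrable M h"
      using that by (auto intro: L2_mult_integrable L2_iter L2_integrable)
    then show ?thesis by (simp add: D_def left_diff_distrib)
  qed
  have diff_right: "D f (\<lambda>x. g x - h x) n = D f g n - D f h n" if "f \<in> L2 M" "h \<in> L2 M" "g \<in> L2 M" for f g h n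
  proof -
    have "integrable M (\<lambda>x. f x * g ((T ^^ n) x))" "integrable M (\<lambda>x. f x * h ((T ^^ n) x))"
        "integrable M g" "integrable M h"
      using that by (auto intro: L2_mult_integrable L2_iter L2_integrable)
    then show ?thesis by (simp add: D_def right_diff_distrib)
  qed
  have "D f g \<longlonglongrightarrow> 0" if f: "f \<in> L2 M" and g: "g \<in> L2 M" for f g
  proof (rule LIMSEQ_I)
    fix \<epsilon> :: real assume "0 < \<epsilon>"
    (* Adding 1 to the norms keeps the tolerances meaningful when a norm vanishes. *)
    define a where "a = \<epsilon> / (8 * (L2_norm M g + 1))"
    have "0 < L2_norm M g + 1" using L2_norm_nonneg[of M g] by linarith
    then have "0 < a" using \<open>0 < \<epsilon>\<close> by (simp add: a_def)
    then obtain f' where f': "f' \<in> Linfty M" "f' \<in> L2 M" "L2_norm M (\<lambda>x. f x - f' x) < a"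
      using L2_Linfty_dense[OF f] by blast
    define b where "b = \<epsilon> / (8 * (L2_norm M f' + 1))"
    have "0 < L2_norm M f' + 1" using L2_norm_nonneg[of M f'] by linarith
    then have "0 < b" using \<open>0 < \<epsilon>\<close> by (simp add: b_def)
    then obtain g' where g': "g' \<in> Linfty M" "g' \<in> L2 M" "L2_norm M (\<lambda>x. g x - g' x) < b"
      using L2_Linfty_dense[OF g] by blast
    have "D f' g' \<longlonglongrightarrow> 0"
      using bounded[OF f'(1) g'(1)] unfolding D_def by (rule LIM_zero)
    then obtain n0 where n0: "\<And>n. n0 \<le> n \<Longrightarrow> norm (D f' g' n) < \<epsilon> / 2"
      using LIMSEQ_D[of "D f' g'" 0 "\<epsilon> / 2"] \<open>0 < \<epsilon>\<close> by auto
    have "norm (D f g n - 0) < \<epsilon>" if "n0 \<le> n" for n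
    proof -
      have "norm (D f g n - D f' g n) \<le> 2 * (L2_norm M (\<lambda>x. f x - f' x) * L2_norm M g)"
        using bound[OF L2_diff[OF f f'(2)] g] by (simp add: diff_left f f' g)
      also have "\<dots> \<le> 2 * (a * (L2_norm M g + 1))"
        using f'(3) \<open>0 < a\<close> by (intro mult_left_mono mult_mono) auto
      also have "\<dots> = \<epsilon> / 4" using \<open>0 < L2_norm M g + 1\<close> by (simp add: a_def field_simps)
      finally have 1: "norm (D f g n - D f' g n) \<le> \<epsilon> / 4" .
      have "norm (D f' g n - D f' g' n) \<le> 2 * (L2_norm M f' * L2_norm M (\<lambda>x. g x - g' x))"
        using bound[OF f'(2) L2_diff[OF g g'(2)]] by (simp add: diff_right g' f' g)
      also have "\<dots> \<le> 2 * ((L2_norm M f' + 1) * b)"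
        using g'(3) \<open>0 < b\<close> \<open>0 < L2_norm M f' + 1\<close> by (intro mult_left_mono mult_mono) auto
      also have "\<dots> = \<epsilon> / 4" using \<open>0 < L2_norm M f' + 1\<close> by (simp add: b_def field_simps)
      finally have 2: "norm (D f' g n - D f' g' n) \<le> \<epsilon> / 4" .
      have "norm (D f g n) \<le> norm (D f g n - D f' g n) + norm (D f' g n - D f' g' n) + norm (D f' g' n)"
        using norm_triangle_ineq[of "D f g n - D f' g n + (D f' g n - D f' g' n)" "D f' g' n"]
          norm_triangle_ineq[of "D f g n - D f' g n" "D f' g n - D f' g' n"] by simp
      then show ?thesis using 1 2 n0[OF that] by simp
    qed
    then show "\<exists>n0. \<forall>n\<ge>n0. norm (D f g n - 0) < \<epsilon>" by blast
  qed
  then show ?thesis unfolding mixing_def koopman_nat D_def by (auto intro: LIM_zero_cancel)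
qed

lemma jointly_ergodic_iff_mixing:
  "jointly_ergodic M T (\<lambda>n. int n) (\<lambda>n. int n + \<lfloor>log 2 (real n)\<rfloor>) \<longleftrightarrow> mixing M T"
  using mixing_of_Linfty jointly_ergodic_imp_mixing_Linfty mixing_imp_jointly_ergodic by blast

section \<open>Ergodicity along the logarithm\<close>

text \<open>
  Let \<open>g\<close> be \<open>f\<close> minus its mean.  The difference of the sums up to \<open>2\<^sup>k\<^sup>+\<^sup>1 - 1\<close> and \<open>2\<^sup>k - 1\<close> is \<open>2\<^sup>k T\<^sup>k g\<close>, so
  the norms of \<open>T\<^sup>k g\<close> tend to zero.  They all equal the norm of \<open>g\<close>, as \<open>T\<close> is an isometry.
\<close>
lemma ergodic_along_log_imp_AE_const:
  assumes erg: "ergodic_along M T (\<lambda>n. \<lfloor>log 2 (real n)\<rfloor>)" and f: "f \<in> Linfty M"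
  shows "AE x in M. f x = (\<integral>y. f y \<partial>M)"
proof -
  define g where "g x = f x - (\<integral>y. f y \<partial>M)" for x
  define F where "F x k = g ((T ^^ k) x)" for k x
  define S where "S N = L2_norm M (\<lambda>x. \<Sum>n=1..N. F x (dyadic_level n))" for N
  have g: "g \<in> L2 M" unfolding g_def by (rule Linfty_L2[OF Linfty_diff[OF f Linfty_const]])
  have F: "(\<lambda>x. F x k) \<in> L2 M" for k unfolding F_def by (rule L2_iter[OF g])
  have lim: "(\<lambda>N. S N / real N) \<longlonglongrightarrow> 0"
    using erg f unfolding ergodic_along_log_iff S_def F_def g_def by blast
  have "2 ^ k * L2_norm M g \<le> S (2 ^ Suc k - 1) + S (2 ^ k - 1)" for k
  proof -
    have "2 ^ k * F x k = (\<Sum>n=1..2 ^ Suc k - 1. F x (dyadic_level n)) - (\<Sum>n=1..2 ^ k - 1. F x (dyadic_level n))" for x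
      unfolding sum_dyadic_block by simp
    then have "L2_norm M (\<lambda>x. 2 ^ k * F x k) \<le> S (2 ^ Suc k - 1) + S (2 ^ k - 1)"
      unfolding S_def by (simp only:) (intro L2_norm_triangle_diff L2_sum F)
    moreover have "L2_norm M (\<lambda>x. 2 ^ k * F x k) = 2 ^ k * L2_norm M g"
      unfolding L2_norm_cmult F_def L2_norm_iter[OF L2_borel[OF g]] by (simp add: norm_power)
    ultimately show ?thesis by simp
  qed
  from sublinear_imp_dyadic_null[OF L2_norm_nonneg this lim]
  have "L2_norm M g = 0" by (simp add: LIMSEQ_const_iff)
  from L2_norm_zero_imp_AE[OF g this] show ?thesis by (simp add: g_def)
qed

lemma ergodic_along_log_imp_zero_one:
  assumes erg: "ergodic_along M T (\<lambda>n. \<lfloor>log 2 (real n)\<rfloor>)" and A: "A \<in> sets M"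
  shows "prob A = 0 \<or> prob A = 1"
proof -
  have [measurable]: "A \<in> sets M" by (rule A)
  have "(indicator A :: 'a \<Rightarrow> complex) \<in> Linfty M"
    by (rule LinftyI[of _ _ 1]) (auto simp: indicator_def)
  from ergodic_along_log_imp_AE_const[OF erg this]
  have "AE x in M. (indicator A x :: complex) = (\<integral>y. indicator A y \<partial>M)" .
  also have "(\<integral>y. (indicator A y :: complex) \<partial>M) = (\<integral>y. of_real (indicator A y) \<partial>M)"
    by (intro Bochner_Integration.integral_cong) (auto simp: indicator_def)
  also have "\<dots> = of_real (prob A)"
    using A by (simp add: Int_absorb2 sets.sets_into_space)
  finally have "AE x in M. (indicator A x :: complex) = of_real (prob A)" .
  from AE_E_prob[OF this] obtain S where "S \<in> sets M" "prob S = 1"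
    "S \<subseteq> {x \<in> space M. (indicator A x :: complex) = of_real (prob A)}" by blast
  moreover from this have "S \<noteq> {}" by auto
  ultimately obtain x where "(indicator A x :: complex) = of_real (prob A)" by blast
  then show ?thesis by (cases "x \<in> A") (auto simp: of_real_eq_iff[of 1 "prob A", symmetric])
qed

lemma concentrated_imp_AE_eq:
  assumes "{x0} \<in> sets M" "prob {x0} = 1"
  shows "AE x in M. x = x0"
  using assms prob_Collect_eq_1[of "\<lambda>x. x = x0"] by (simp add: prob_eq_1)

lemma concentrated_imp_ergodic_along_log:
  assumes "concentrated_on_point M"
  shows "ergodic_along M T (\<lambda>n. \<lfloor>log 2 (real n)\<rfloor>)"
  unfolding ergodic_along_log_iff
proof
  fix f assume f: "f \<in> Linfty M"
  obtain x0 where x0: "x0 \<in> space M" "{x0} \<in> sets M" "prob {x0} = 1"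
    using assms by (auto simp: concentrated_on_point_def)
  have AE: "AE x in M. x = x0" by (rule concentrated_imp_AE_eq[OF x0(2,3)])
  have "(\<integral>y. f y \<partial>M) = (\<integral>y. f x0 \<partial>M)"
    using AE Linfty_borel[OF f] by (intro integral_cong_AE) (auto elim: eventually_mono)
  then have int: "(\<integral>y. f y \<partial>M) = f x0" by (simp add: prob_space)
  have "AE x in M. \<forall>k. (T ^^ k) x = x0"
    unfolding AE_all_countable using AE_iter[OF AE] by blast
  then have "AE x in M. (\<Sum>n=1..N. f ((T ^^ dyadic_level n) x) - f x0) = 0" for N
    by eventually_elim simp
  then have "L2_norm M (\<lambda>x. \<Sum>n=1..N. f ((T ^^ dyadic_level n) x) - f x0) = L2_norm M (\<lambda>x. 0)" for N
    using borel_measurable_iter[OF Linfty_borel[OF f]] by (intro L2_norm_cong_AE) auto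
  then show "(\<lambda>N. L2_norm M (\<lambda>x. \<Sum>n=1..N. f ((T ^^ dyadic_level n) x) - (\<integral>y. f y \<partial>M)) / real N) \<longlonglongrightarrow> 0"
    unfolding int by simp
qed

section \<open>One-point systems\<close>

text \<open>
  In the forward direction, a bijection onto at most one point makes the conull set \<open>A\<close> a singleton.
  Conversely, the atom \<open>x0\<close> is fixed by \<open>T\<close>: almost every point, and almost every image of a point, is
  \<open>x0\<close>, so that \<open>{x0}\<close> is an invariant conull set.
\<close>
lemma conjugate_to_one_point_iff:
  "conjugate_to_one_point M T \<longleftrightarrow> concentrated_on_point M"
proof
  assume "conjugate_to_one_point M T"
  then obtain A B \<phi> where A: "conull M A"
    and iso: "measure_iso (restrict_space M A) (restrict_space (count_space {()}) B) \<phi>"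
    unfolding conjugate_to_one_point_def conjugate_def by blast
  have "A \<in> sets M" "prob (space M - A) = 0"
    using A by (auto simp: conull_def measure_eq_0_null_sets)
  then have "prob A = 1" by (simp add: prob_compl)
  then obtain x where "x \<in> A" by fastforce
  have "space (restrict_space M A) = A"
    using \<open>A \<in> sets M\<close> by (simp add: space_restrict_space Int_absorb2 sets.sets_into_space)
  then have "inj_on \<phi> A" using iso by (auto simp: measure_iso_def bij_betw_def)
  then have "A = {x}" using \<open>x \<in> A\<close> by (auto simp: inj_on_def)
  then show "concentrated_on_point M"
    unfolding concentrated_on_point_def using \<open>A \<in> sets M\<close> \<open>prob A = 1\<close> sets.sets_into_space by blast
next
  assume "concentrated_on_point M"
  then obtain x0 where x0: "x0 \<in> space M" "{x0} \<in> sets M" "prob {x0} = 1"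
    by (auto simp: concentrated_on_point_def)
  have AE: "AE x in M. x = x0" by (rule concentrated_imp_AE_eq[OF x0(2,3)])
  have "AE x in M. T x0 = x0"
    using AE AE_iter[OF AE, of 1] by eventually_elim simp
  then have fixed: "T x0 = x0" by simp
  have A: "conull M {x0}"
    unfolding conull_def using x0 by (auto simp: null_sets_def emeasure_eq_measure prob_compl)
  let ?P = "restrict_space M {x0}" and ?Q = "restrict_space (count_space {()}) {()}"
  have sP: "space ?P = {x0}" using x0 by (auto simp: space_restrict_space)
  have sQ: "space ?Q = {()}" "sets ?Q = UNIV" by (auto simp: space_restrict_space sets_restrict_space Pow_def UNIV_unit)
  have meas: "(\<lambda>_. ()) \<in> ?P \<rightarrow>\<^sub>M ?Q" by (rule measurable_const) (simp add: sQ)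
  have "measure_iso ?P ?Q (\<lambda>_. ())"
    unfolding measure_iso_def
  proof (intro conjI meas)
    show "bij_betw (\<lambda>_. ()) (space ?P) (space ?Q)" by (simp add: sP sQ bij_betw_def)
    have "inv_into (space ?P) (\<lambda>_. ()) () = x0" using inv_into_into[of "()" "\<lambda>_. ()" "{x0}"] by (simp add: sP)
    then have "inv_into (space ?P) (\<lambda>_. ()) = (\<lambda>_. x0)" by auto
    moreover have "(\<lambda>_. x0) \<in> ?Q \<rightarrow>\<^sub>M ?P" by (rule measurable_const) (simp add: sP)
    ultimately show "inv_into (space ?P) (\<lambda>_. ()) \<in> ?Q \<rightarrow>\<^sub>M ?P" by simp
    show "distr ?P ?Q (\<lambda>_. ()) = ?Q"
    proof (rule measure_eqI)
      fix X assume "X \<in> sets (distr ?P ?Q (\<lambda>_. ()))"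
      have "emeasure (distr ?P ?Q (\<lambda>_. ())) X = emeasure ?P ((\<lambda>_. ()) -` X \<inter> space ?P)"
        by (rule emeasure_distr[OF meas]) (simp add: sQ)
      also have "\<dots> = emeasure ?Q X"
      proof (cases "X = {}")
        case False
        then have X: "X = {()}" by auto
        have "emeasure ?P {x0} = 1"
          using x0 by (subst emeasure_restrict_space) (auto simp: emeasure_eq_measure)
        moreover have "emeasure ?Q {()} = 1" by (subst emeasure_restrict_space) auto
        ultimately show ?thesis by (simp add: X sP)
      qed simp
      finally show "emeasure (distr ?P ?Q (\<lambda>_. ())) X = emeasure ?Q X" .
    qed simp
  qed
  moreover have "conull (count_space {()}) {()}" by (simp add: conull_def)
  ultimately show "conjugate_to_one_point M T"
    unfolding conjugate_to_one_point_def conjugate_def using A fixed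
    by (intro exI[of _ "{x0}"] exI[of _ "{()}"] exI[of _ "\<lambda>_. ()"]) auto
qed

end

section \<open>Zero-one laws on Lebesgue spaces\<close>

lemma iso_mod_null_emeasure:
  assumes "iso_mod_null P Q" and S: "S \<in> sets Q"
  obtains E where "E \<in> sets P" "emeasure P E = emeasure Q S"
proof -
  obtain A B \<phi> where A: "conull P A" and B: "conull Q B"
    and iso: "measure_iso (restrict_space P A) (restrict_space Q B) \<phi>"
    using assms by (auto simp: iso_mod_null_def)
  have sA: "A \<in> sets P" "A \<subseteq> space P" and sB: "B \<in> sets Q"
    using A B sets.sets_into_space by (auto simp: conull_def)
  have meas: "\<phi> \<in> restrict_space P A \<rightarrow>\<^sub>M restrict_space Q B"
    and distr: "distr (restrict_space P A) (restrict_space Q B) \<phi> = restrict_space Q B"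
    using iso by (auto simp: measure_iso_def)
  define E where "E = \<phi> -` (S \<inter> B) \<inter> A"
  have SB: "S \<inter> B \<in> sets (restrict_space Q B)"
    using S by (auto simp: sets_restrict_space)
  have space: "space (restrict_space P A) = A" using sA by (auto simp: space_restrict_space)
  have "E \<in> sets (restrict_space P A)"
    using measurable_sets[OF meas SB] by (simp add: E_def space)
  then have E: "E \<in> sets P" using sA by (simp add: sets_restrict_space_iff)
  have "AE x in Q. x \<in> B" using B by (auto simp: conull_def intro!: AE_I'[of "space Q - B"])
  then have "emeasure Q S = emeasure Q (S \<inter> B)"
    using S sB by (intro emeasure_eq_AE) auto
  also have "\<dots> = emeasure (restrict_space Q B) (S \<inter> B)"
    using sB sets.sets_into_space[OF sB] by (subst emeasure_restrict_space) auto
  also have "\<dots> = emeasure (distr (restrict_space P A) (restrict_space Q B) \<phi>) (S \<inter> B)"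
    by (simp only: distr)
  also have "\<dots> = emeasure (restrict_space P A) E"
    using emeasure_distr[OF meas SB] by (simp add: E_def space)
  also have "\<dots> = emeasure P E"
    using sA by (subst emeasure_restrict_space) (auto simp: E_def)
  finally show ?thesis using E that by simp
qed

text \<open>
  An atom in \<open>C\<close> has positive measure, hence measure one.  Without atoms the completed
  space is isomorphic, modulo null sets, to the unit interval, and \<open>[0, 1/2]\<close> corresponds to a set
  of measure \<open>1/2\<close>, which the zero-one law forbids.  That set need only be measurable in the
  completion; its main part is a measurable set of the same measure.
\<close>
lemma zero_one_lebesgue_imp_concentrated:
  assumes leb: "lebesgue_prob_space M"
    and zo: "\<And>A. A \<in> sets M \<Longrightarrow> measure M A = 0 \<or> measure M A = 1"
  shows "concentrated_on_point M"
proof -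
  interpret prob_space M using leb by (simp add: lebesgue_prob_space_def)
  obtain C where C: "C \<subseteq> space M" "\<And>x. x \<in> C \<Longrightarrow> prob {x} > 0"
    and iso: "iso_mod_null (restrict_space (completion M) (space M - C)) (lebesgue_on {0..prob (space M - C)})"
    using leb by (auto simp: lebesgue_prob_space_def)
  show ?thesis
  proof (cases "C = {}")
    case False
    then obtain x where x: "x \<in> C" by blast
    then have "{x} \<in> sets M" using C(2)[of x] measure_notin_sets[of "{x}" M] by force
    moreover from this have "prob {x} = 1" using zo[of "{x}"] C(2)[OF x] by auto
    ultimately show ?thesis using C x by (auto simp: concentrated_on_point_def)
  next
    case True
    let ?P = "restrict_space (completion M) (space M)"
    have "iso_mod_null ?P (lebesgue_on {0..1::real})"
      using iso by (simp add: True prob_space)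
    moreover have "{0..1/2} \<in> sets (lebesgue_on {0..1::real})"
      by (simp add: sets_restrict_space_iff)
    ultimately obtain E where E: "E \<in> sets ?P"
      and mE: "emeasure ?P E = emeasure (lebesgue_on {0..1::real}) {0..1/2}"
      by (rule iso_mod_null_emeasure)
    have E': "E \<in> sets (completion M)" "E \<subseteq> space M"
      using E sets.top[of "completion M"] sets.sets_into_space[OF E] by (auto simp: sets_restrict_space_iff space_restrict_space)
    have "ennreal (prob (main_part M E)) = emeasure (completion M) E"
      using E' by (simp add: emeasure_completion flip: emeasure_eq_measure)
    also have "\<dots> = emeasure ?P E"
      using E' sets.top[of "completion M"] by (subst emeasure_restrict_space) auto
    also have "\<dots> = emeasure lebesgue {0..1/2::real}"
      unfolding mE by (subst emeasure_restrict_space) auto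
    also have "\<dots> = ennreal (1/2)" by simp
    finally have "prob (main_part M E) = 1/2" by (subst (asm) ennreal_inj) auto
    then show ?thesis using zo[of "main_part M E"] E' by auto
  qed
qed

theorem theorem1p10:
  fixes M :: "'a measure" and T :: "'a \<Rightarrow> 'a"
  assumes "mp_system M T"
  shows "(jointly_ergodic M T (\<lambda>n. int n) (\<lambda>n. int n + \<lfloor>log 2 (real n)\<rfloor>) \<longleftrightarrow> mixing M T) \<and>
    (ergodic_along M T (\<lambda>n. \<lfloor>log 2 (real n)\<rfloor>) \<longleftrightarrow> conjugate_to_one_point M T) \<and>
    (conjugate_to_one_point M T \<longleftrightarrow> concentrated_on_point M) \<and>
    (mixing M T \<and> \<not> conjugate_to_one_point M T \<longrightarrow>
       jointly_ergodic M T (\<lambda>n. int n) (\<lambda>n. int n + \<lfloor>log 2 (real n)\<rfloor>) \<and>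
       \<not> ergodic_along M T (\<lambda>n. \<lfloor>log 2 (real n)\<rfloor>))"
proof -
  have leb: "lebesgue_prob_space M" and iso: "measure_iso M M T"
    using assms by (auto simp: mp_system_def)
  interpret measure_preserving M T
    using leb iso
    by (auto simp: lebesgue_prob_space_def measure_iso_def measure_preserving_def measure_preserving_axioms_def)
  have "ergodic_along M T (\<lambda>n. \<lfloor>log 2 (real n)\<rfloor>) \<longleftrightarrow> concentrated_on_point M"
    using zero_one_lebesgue_imp_concentrated[OF leb] ergodic_along_log_imp_zero_one
      concentrated_imp_ergodic_along_log by blast
  then show ?thesis
    using jointly_ergodic_iff_mixing conjugate_to_one_point_iff by blast
qed

end
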